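(* Let $Y$ be a normed linear space and let $T\in\mathcal{L}(\ell_1^n,Y)$ with $\|T\|=1$ be such that, for each $1\le i\le n$, $T$ is $BD^{\varepsilon_i}$-P at $e_i$ for some $\varepsilon_i\in[0,1)$. Then $T$ is $BD^\eta$-P for some $\eta\in[0,1)$.
   Context: All normed spaces are real; $\ell_1^n$ is $\mathbb{R}^n$ with the $\ell_1$ norm and $\{e_1,\dots,e_n\}$ is its standard unit vector basis; $\mathcal{L}(X,Y)$ is the space of bounded linear operators from $X$ to $Y$ with the operator norm. $x\perp_B y$ means $\|x+\lambda y\|\ge\|x\|$ for all $\lambda\in\mathbb{R}$. For $\varepsilon\in[0,1)$, $x\perp_{D^\varepsilon}y$ means $\|x+\lambda y\|\ge\sqrt{1-\varepsilon^2}\,\|x\|$ for all $\lambda\in\mathbb{R}$. For $\eta\in[0,1)$, $T\in\mathcal{L}(X,Y)$ is $BD^\eta$-P at $x\in X$ if for all $y\in X$, $x\perp_B y$ implies $Tx\perp_{D^\eta}Ty$; $T$ is $BD^\eta$-P if this holds at every $x\in X$ (with the same $\eta$). *)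

theory Defs
  imports "HOL-Analysis.Analysis"
begin

text \<open>The library norm on \<^typ>\<open>real ^ 'n\<close> is Euclidean, so the space $\ell_1^n$, with $n$ the
  cardinality of the finite index type \<open>'n\<close>, is a separate type.\<close>

typedef 'n ell1 = "UNIV :: ('n \<Rightarrow> real) set"
  morphisms ell1_nth Ell1
  by simp

setup_lifting type_definition_ell1

lemma ell1_eq_iff: "x = y \<longleftrightarrow> (\<forall>i. ell1_nth x i = ell1_nth y i)"
  by transfer (simp add: fun_eq_iff)

instantiation ell1 :: (type) scaleR
begin

lift_definition scaleR_ell1 :: "real \<Rightarrow> 'a ell1 \<Rightarrow> 'a ell1" is "\<lambda>c x i. c * x i" .

instance ..

end

instantiation ell1 :: (finite) real_normed_vector
begin

lift_definition zero_ell1 :: "'a ell1" is "\<lambda>i. 0" .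
lift_definition plus_ell1 :: "'a ell1 \<Rightarrow> 'a ell1 \<Rightarrow> 'a ell1" is "\<lambda>x y i. x i + y i" .
lift_definition minus_ell1 :: "'a ell1 \<Rightarrow> 'a ell1 \<Rightarrow> 'a ell1" is "\<lambda>x y i. x i - y i" .
lift_definition uminus_ell1 :: "'a ell1 \<Rightarrow> 'a ell1" is "\<lambda>x i. - x i" .
lift_definition norm_ell1 :: "'a ell1 \<Rightarrow> real" is "\<lambda>x. \<Sum>i\<in>UNIV. \<bar>x i\<bar>" .

definition sgn_ell1 :: "'a ell1 \<Rightarrow> 'a ell1"
  where "sgn_ell1 x = x /\<^sub>R norm x"

definition dist_ell1 :: "'a ell1 \<Rightarrow> 'a ell1 \<Rightarrow> real"
  where "dist_ell1 x y = norm (x - y)"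

definition uniformity_ell1 :: "('a ell1 \<times> 'a ell1) filter"
  where "uniformity_ell1 = (INF e\<in>{0<..}. principal {(x, y). dist x y < e})"

definition open_ell1 :: "'a ell1 set \<Rightarrow> bool"
  where "open_ell1 U \<longleftrightarrow> (\<forall>x\<in>U. \<forall>\<^sub>F (x', y) in uniformity. x' = x \<longrightarrow> y \<in> U)"

instance
proof
  fix x y z :: "'a ell1" and a b :: real
  show "x + y + z = x + (y + z)" by transfer (simp add: add.assoc)
  show "x + y = y + x" by transfer (simp add: add.commute)
  show "0 + x = x" by transfer simp
  show "- x + x = 0" by transfer simp
  show "x - y = x + - y" by transfer simp
  show "a *\<^sub>R (x + y) = a *\<^sub>R x + a *\<^sub>R y" by transfer (simp add: distrib_left)
  show "(a + b) *\<^sub>R x = a *\<^sub>R x + b *\<^sub>R x" by transfer (simp add: distrib_right)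
  show "a *\<^sub>R b *\<^sub>R x = (a * b) *\<^sub>R x" by transfer (simp add: mult.assoc)
  show "1 *\<^sub>R x = x" by transfer simp
  show "norm x = 0 \<longleftrightarrow> x = 0"
    by transfer (simp add: sum_nonneg_eq_0_iff fun_eq_iff)
  show "norm (x + y) \<le> norm x + norm y"
    by transfer (simp add: sum.distrib [symmetric] sum_mono abs_triangle_ineq)
  show "norm (a *\<^sub>R x) = \<bar>a\<bar> * norm x"
    by transfer (simp add: abs_mult sum_distrib_left)
qed (fact sgn_ell1_def dist_ell1_def uniformity_ell1_def open_ell1_def)+

end

lift_definition ell1_basis :: "'n \<Rightarrow> 'n ell1" is "\<lambda>i j. if j = i then 1 else 0" .

definition orth_B :: "'a::real_normed_vector \<Rightarrow> 'a \<Rightarrow> bool"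
  where "orth_B x y \<longleftrightarrow> (\<forall>c::real. norm (x + c *\<^sub>R y) \<ge> norm x)"

definition orth_D :: "real \<Rightarrow> 'a::real_normed_vector \<Rightarrow> 'a \<Rightarrow> bool"
  where "orth_D \<epsilon> x y \<longleftrightarrow> (\<forall>c::real. norm (x + c *\<^sub>R y) \<ge> sqrt (1 - \<epsilon>\<^sup>2) * norm x)"

text \<open>\<open>orth_D\<close>, \<open>BD_P_at\<close> and \<open>BD_P\<close> are only meant for parameters in $[0,1)$; this range is
  not built into the definitions and has to be stated wherever they are used.\<close>

definition BD_P_at ::
    "real \<Rightarrow> ('a::real_normed_vector \<Rightarrow>\<^sub>L 'b::real_normed_vector) \<Rightarrow> 'a \<Rightarrow> bool"
  where "BD_P_at \<eta> T x \<longleftrightarrow> (\<forall>y. orth_B x y \<longrightarrow> orth_D \<eta> (blinfun_apply T x) (blinfun_apply T y))"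

definition BD_P :: "real \<Rightarrow> ('a::real_normed_vector \<Rightarrow>\<^sub>L 'b::real_normed_vector) \<Rightarrow> bool"
  where "BD_P \<eta> T \<longleftrightarrow> (\<forall>x. BD_P_at \<eta> T x)"

end

theory Submission
  imports Defs
begin

text \<open>Some \<open>T e\<^sub>i\<close> is nonzero. For every unit vector \<open>u\<close> with \<open>u\<^sub>i \<ge> 0\<close>, the vector \<open>e\<^sub>i\<close> is
  Birkhoff--James orthogonal to \<open>u - e\<^sub>i\<close>, so the hypothesis at this single \<open>e\<^sub>i\<close> bounds
  \<open>T u = T e\<^sub>i + T (u - e\<^sub>i)\<close> from below: \<open>T\<close> is bounded below by a constant \<open>m > 0\<close>. An operator with
  norm at most 1 that is bounded below by \<open>m\<close> has the property with \<open>\<eta> = sqrt (1 - m\<^sup>2)\<close>.\<close>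

lemma norm_ell1_split:
  fixes x :: "'n::finite ell1"
  shows "norm x = \<bar>ell1_nth x i\<bar> + (\<Sum>j\<in>UNIV - {i}. \<bar>ell1_nth x j\<bar>)"
  by (simp add: norm_ell1.rep_eq sum.remove[of UNIV i])

lemma norm_ell1_basis [simp]: "norm (ell1_basis i :: 'n::finite ell1) = 1"
  by transfer (simp add: if_distrib cong: if_cong)

lemma ell1_nth_sum:
  "ell1_nth (\<Sum>i\<in>A. f i :: 'n::finite ell1) j = (\<Sum>i\<in>A. ell1_nth (f i) j)"
  by (induction A rule: infinite_finite_induct)
    (simp_all add: zero_ell1.rep_eq plus_ell1.rep_eq)

lemma ell1_basis_expansion:
  fixes x :: "'n::finite ell1"
  shows "x = (\<Sum>i\<in>UNIV. ell1_nth x i *\<^sub>R ell1_basis i)"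
  by (simp add: ell1_eq_iff ell1_nth_sum scaleR_ell1.rep_eq ell1_basis.rep_eq if_distrib cong: if_cong)

lemma blinfun_ell1_eq_0:
  fixes T :: "'n::finite ell1 \<Rightarrow>\<^sub>L 'b::real_normed_vector"
  assumes "\<And>i. blinfun_apply T (ell1_basis i) = 0"
  shows "T = 0"
proof (rule blinfun_eqI)
  fix x
  have "blinfun_apply T x = (\<Sum>i\<in>UNIV. ell1_nth x i *\<^sub>R blinfun_apply T (ell1_basis i))"
    using arg_cong[OF ell1_basis_expansion, of "blinfun_apply T" x]
    by (simp only: blinfun.sum_right blinfun.scaleR_right)
  then show "blinfun_apply T x = blinfun_apply 0 x"
    by (simp add: assms)
qed

text \<open>On the line from \<open>e_i\<close> towards \<open>u\<close>, the coordinates other than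
  \<open>i\<close> contribute \<open>\<bar>c\<bar> * (1 - u_i)\<close>, since their absolute values
  in \<open>u\<close> sum to \<open>1 - u_i\<close>. This makes up for any loss in coordinate
  \<open>i\<close>.\<close>

lemma orth_B_ell1_basis:
  fixes u :: "'n::finite ell1"
  assumes "norm u = 1" "ell1_nth u i \<ge> 0"
  shows "orth_B (ell1_basis i) (u - ell1_basis i)"
  unfolding orth_B_def
proof
  fix c :: real
  let ?w = "ell1_basis i + c *\<^sub>R (u - ell1_basis i)"
  have rest: "(\<Sum>j\<in>UNIV - {i}. \<bar>ell1_nth u j\<bar>) = 1 - ell1_nth u i"
    using norm_ell1_split[of u i] assms by simp
  have nth_w: "ell1_nth ?w j = (if j = i then 1 - c * (1 - ell1_nth u i) else c * ell1_nth u j)" for j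
    by (simp add: plus_ell1.rep_eq minus_ell1.rep_eq scaleR_ell1.rep_eq ell1_basis.rep_eq right_diff_distrib)
  have "norm ?w = \<bar>1 - c * (1 - ell1_nth u i)\<bar> + (\<Sum>j\<in>UNIV - {i}. \<bar>c\<bar> * \<bar>ell1_nth u j\<bar>)"
    unfolding norm_ell1_split[of ?w i] nth_w by (simp add: abs_mult)
  also have "\<dots> = \<bar>1 - c * (1 - ell1_nth u i)\<bar> + \<bar>c\<bar> * (1 - ell1_nth u i)"
    by (simp add: sum_distrib_left[symmetric] rest)
  \<comment> \<open>\<open>1 - u_i\<close> is a sum of absolute values, hence nonnegative, so it may
    move inside \<open>\<bar>c\<bar>\<close>. What remains is the triangle inequality for
    \<open>(1 - t) + t = 1\<close>.\<close>
  also have "\<dots> = \<bar>1 - c * (1 - ell1_nth u i)\<bar> + \<bar>c * (1 - ell1_nth u i)\<bar>"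
    using rest sum_nonneg[of "UNIV - {i}" "\<lambda>j. \<bar>ell1_nth u j\<bar>"] by (simp add: abs_mult)
  also have "\<dots> \<ge> 1"
    by linarith
  finally show "norm (ell1_basis i :: 'n ell1) \<le> norm ?w"
    by simp
qed

lemma BD_P_at_ell1_basis_bounded_below:
  fixes T :: "'n::finite ell1 \<Rightarrow>\<^sub>L 'b::real_normed_vector"
  assumes "BD_P_at \<epsilon> T (ell1_basis i)"
  shows "sqrt (1 - \<epsilon>\<^sup>2) * norm (blinfun_apply T (ell1_basis i)) * norm v \<le> norm (blinfun_apply T v)"
proof (cases "v = 0")
  case False
  \<comment> \<open>The sign makes the \<open>i\<close>-th coordinate of \<open>u\<close>
    nonnegative and leaves the norms of \<open>u\<close> and \<open>T u\<close> unchanged.\<close>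
  define s :: real where "s = (if ell1_nth v i \<ge> 0 then 1 else - 1)"
  define u where "u = (s / norm v) *\<^sub>R v"
  have "\<bar>s\<bar> = 1"
    by (simp add: s_def)
  then have norm_u: "norm u = 1" and norm_Tu: "norm (blinfun_apply T u) = norm (blinfun_apply T v) / norm v"
    using False by (simp_all add: u_def blinfun.scaleR_right)
  have "ell1_nth u i \<ge> 0"
    by (auto simp: u_def s_def scaleR_ell1.rep_eq divide_nonpos_nonneg)
  then have "orth_D \<epsilon> (blinfun_apply T (ell1_basis i)) (blinfun_apply T (u - ell1_basis i))"
    using orth_B_ell1_basis[OF norm_u] assms by (simp add: BD_P_at_def)
  \<comment> \<open>The choice \<open>c = 1\<close> turns the perturbed vector into
    \<open>T u\<close>.\<close>
  then have "sqrt (1 - \<epsilon>\<^sup>2) * norm (blinfun_apply T (ell1_basis i))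
      \<le> norm (blinfun_apply T (ell1_basis i) + 1 *\<^sub>R blinfun_apply T (u - ell1_basis i))"
    unfolding orth_D_def by blast
  also have "\<dots> = norm (blinfun_apply T v) / norm v"
    by (simp add: blinfun.diff_right norm_Tu)
  finally show ?thesis
    using False by (simp add: field_simps)
qed simp

text \<open>The parameter solves \<open>sqrt (1 - \<eta>\<^sup>2) = m\<close>. If \<open>x\<close>
  is orthogonal to \<open>y\<close>, then \<open>m * norm (T x) \<le> m * norm x \<le> m * norm (x +
  c y) \<le> norm (T (x + c y))\<close>.\<close>

lemma bounded_below_imp_BD_P:
  fixes T :: "'a::real_normed_vector \<Rightarrow>\<^sub>L 'b::real_normed_vector"
  assumes "norm T \<le> 1" "0 \<le> m" "m \<le> 1"
    and below: "\<And>v. m * norm v \<le> norm (blinfun_apply T v)"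
  shows "BD_P (sqrt (1 - m\<^sup>2)) T"
  unfolding BD_P_def BD_P_at_def orth_D_def
proof (intro allI impI)
  fix x y :: 'a and c :: real
  assume orth: "orth_B x y"
  have "m\<^sup>2 \<le> 1"
    using assms(2,3) by (rule power_le_one)
  then have m: "sqrt (1 - (sqrt (1 - m\<^sup>2))\<^sup>2) = m"
    using assms(2) by simp
  have "norm (blinfun_apply T x) \<le> norm x"
    using norm_blinfun[of T x] mult_right_mono[OF assms(1), of "norm x"] by simp
  also have "norm x \<le> norm (x + c *\<^sub>R y)"
    using orth by (simp add: orth_B_def)
  finally have "m * norm (blinfun_apply T x) \<le> m * norm (x + c *\<^sub>R y)"
    using assms(2) by (rule mult_left_mono)
  also have "\<dots> \<le> norm (blinfun_apply T (x + c *\<^sub>R y))"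
    by (rule below)
  finally show "sqrt (1 - (sqrt (1 - m\<^sup>2))\<^sup>2) * norm (blinfun_apply T x)
      \<le> norm (blinfun_apply T x + c *\<^sub>R blinfun_apply T y)"
    by (simp only: m blinfun.bilinear_simps)
qed

theorem corollary3p5:
  fixes T :: "'n::finite ell1 \<Rightarrow>\<^sub>L 'b::real_normed_vector"
  assumes "norm T = 1"
    and "\<forall>i. \<exists>\<epsilon>\<in>{0..<1}. BD_P_at \<epsilon> T (ell1_basis i)"
  shows "\<exists>\<eta>\<in>{0..<1}. BD_P \<eta> T"
proof -
  \<comment> \<open>An index with \<open>T e_i = 0\<close> would only give the trivial bound
    \<open>m = 0\<close>.\<close>
  obtain i where i: "blinfun_apply T (ell1_basis i) \<noteq> 0"
    using blinfun_ell1_eq_0[of T] assms(1) by force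
  obtain \<epsilon> where \<epsilon>: "0 \<le> \<epsilon>" "\<epsilon> < 1" "BD_P_at \<epsilon> T (ell1_basis i)"
    using assms(2) by force
  define m where "m = sqrt (1 - \<epsilon>\<^sup>2) * norm (blinfun_apply T (ell1_basis i))"
  have "\<epsilon>\<^sup>2 < 1"
    using \<epsilon> by (simp add: power_less_one_iff abs_square_less_1)
  then have m_pos: "0 < m"
    using i by (simp add: m_def)
  have m_le: "m \<le> 1"
    unfolding m_def
    using norm_blinfun[of T "ell1_basis i"] assms(1) by (intro mult_le_one) auto
  have "m\<^sup>2 \<le> 1"
    using m_pos m_le by (simp add: power_le_one)
  \<comment> \<open>Positivity of \<open>m\<close> keeps the parameter strictly below 1.\<close>
  then have "sqrt (1 - m\<^sup>2) \<in> {0..<1}"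
    using m_pos by simp
  moreover have "BD_P (sqrt (1 - m\<^sup>2)) T"
    using BD_P_at_ell1_basis_bounded_below[OF \<epsilon>(3)] assms(1) m_pos m_le
    by (intro bounded_below_imp_BD_P) (auto simp: m_def)
  ultimately show ?thesis
    by blast
qed

end
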